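(* There exist two subgraphs $X,Y$ of the $2$-dimensional integer grid (the Cayley graph of $\mathbb{Z}^2$ with respect to the standard generators) such that for every integer $k\geq 2$ there is an infinite subset $I_k\subset\mathbb{N}$ such that for all $n\in I_k$: (a) $\mathrm{wir}^{k-1}_{X\to Y}(n)\geq \left(\frac{n}{k(k+1)}\right)^2$, and (b) $\mathrm{wir}^{k}_{X\to Y}(n)\leq 2n$.
   Context: All graphs are simple, undirected. A wiring of a finite graph $\Gamma$ into a graph $Y$ is a continuous map $f:\Gamma\to Y$ (graphs viewed as 1-dimensional cell complexes) sending vertices to vertices and each edge of $\Gamma$ onto a union of edges of $Y$ (i.e. onto a path in $Y$ between the images of its endpoints, or onto a single vertex when both endpoints have the same image). A wiring $f$ is a coarse $k$-wiring if (1) $|\{v\in V\Gamma: f(v)=w\}|\leq k$ for every $w\in VY$, and (2) every edge of $Y$ is contained in the images $f(e)$ of at most $k$ edges $e\in E\Gamma$. The image $\mathrm{im}(f)$ is the subgraph of $Y$ consisting of all vertices and edges in the image of $f$; the volume $\mathrm{vol}(f)$ is the number of vertices of $\mathrm{im}(f)$. $\mathrm{wir}^k(\Gamma\to Y)$ is the minimal volume of a coarse $k$-wiring of $\Gamma$ into $Y$ ($+\infty$ if none exists). For graphs $X,Y$, the $k$-wiring profile is $\mathrm{wir}^k_{X\to Y}(n)=\max\{\mathrm{wir}^k(\Gamma\to Y): \Gamma \text{ a subgraph of } X,\ |V\Gamma|\leq n\}$. *)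

theory Defs
  imports Main "HOL-Library.Extended_Nat"
begin

type_synonym 'a graph = "'a set \<times> 'a set set"

definition verts :: "'a graph \<Rightarrow> 'a set" where "verts G = fst G"
definition edges :: "'a graph \<Rightarrow> 'a set set" where "edges G = snd G"

definition wf_graph :: "'a graph \<Rightarrow> bool" where
  "wf_graph G \<longleftrightarrow> (\<forall>e\<in>edges G. \<exists>u v. u \<noteq> v \<and> e = {u, v} \<and> u \<in> verts G \<and> v \<in> verts G)"

definition subgraph :: "'a graph \<Rightarrow> 'a graph \<Rightarrow> bool" where
  "subgraph G H \<longleftrightarrow> wf_graph G \<and> verts G \<subseteq> verts H \<and> edges G \<subseteq> edges H"

definition grid2 :: "(int \<times> int) graph" where
  "grid2 = (UNIV, {{p, q} | p q. \<bar>fst p - fst q\<bar> + \<bar>snd p - snd q\<bar> = 1})"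

definition is_path :: "'b graph \<Rightarrow> 'b list \<Rightarrow> bool" where
  "is_path Y xs \<longleftrightarrow> xs \<noteq> [] \<and> distinct xs \<and> set xs \<subseteq> verts Y \<and>
     (\<forall>i. Suc i < length xs \<longrightarrow> {xs ! i, xs ! Suc i} \<in> edges Y)"

definition path_edges :: "'b list \<Rightarrow> 'b set set" where
  "path_edges xs = {{xs ! i, xs ! Suc i} | i. Suc i < length xs}"

text \<open>A wiring of G into Y: a vertex map fv and, for every edge e of G, a path fp e in Y
joining the images of the endpoints of e (a single vertex if they coincide).\<close>
definition is_wiring :: "'a graph \<Rightarrow> 'b graph \<Rightarrow> ('a \<Rightarrow> 'b) \<Rightarrow> ('a set \<Rightarrow> 'b list) \<Rightarrow> bool" where
  "is_wiring G Y fv fp \<longleftrightarrow> (\<forall>v\<in>verts G. fv v \<in> verts Y) \<and>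
     (\<forall>e\<in>edges G. is_path Y (fp e) \<and> {hd (fp e), last (fp e)} = fv ` e)"

definition coarse_wiring :: "nat \<Rightarrow> 'a graph \<Rightarrow> 'b graph \<Rightarrow> ('a \<Rightarrow> 'b) \<Rightarrow> ('a set \<Rightarrow> 'b list) \<Rightarrow> bool" where
  "coarse_wiring k G Y fv fp \<longleftrightarrow> is_wiring G Y fv fp \<and>
     (\<forall>w\<in>verts Y. card {v\<in>verts G. fv v = w} \<le> k) \<and>
     (\<forall>d\<in>edges Y. card {e\<in>edges G. d \<in> path_edges (fp e)} \<le> k)"

definition image_verts :: "'a graph \<Rightarrow> ('a \<Rightarrow> 'b) \<Rightarrow> ('a set \<Rightarrow> 'b list) \<Rightarrow> 'b set" where
  "image_verts G fv fp = fv ` verts G \<union> (\<Union>e\<in>edges G. set (fp e))"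

definition vol :: "'a graph \<Rightarrow> ('a \<Rightarrow> 'b) \<Rightarrow> ('a set \<Rightarrow> 'b list) \<Rightarrow> nat" where
  "vol G fv fp = card (image_verts G fv fp)"

text \<open>Minimal volume of a coarse k-wiring (infinity if none exists).\<close>
definition wir :: "nat \<Rightarrow> 'a graph \<Rightarrow> 'b graph \<Rightarrow> enat" where
  "wir k G Y = (INF p \<in> {(fv, fp). coarse_wiring k G Y fv fp}. enat (vol G (fst p) (snd p)))"

definition wir_profile :: "nat \<Rightarrow> 'a graph \<Rightarrow> 'b graph \<Rightarrow> nat \<Rightarrow> enat" where
  "wir_profile k X Y n = (SUP G \<in> {G. subgraph G X \<and> finite (verts G) \<and> card (verts G) \<le> n}. wir k G Y)"

end

(*
  X and Y are disjoint unions of ladders: block j has k j rows, joined by 5 (k j) + 1 columns, which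
  are evenly spaced along the rows with a much larger spacing in Y than in X; every k >= 2 occurs
  infinitely often as k j, and the spacings grow so fast that different blocks do not interact.

  Upper bound: projecting block j of X to a single row of block j of Y is a coarse (k j)-wiring of
  small volume.  Earlier blocks fit into their counterparts in Y, which are few and small; of the
  later blocks a graph with few vertices misses an edge of every row segment, so it embeds without
  loss, the segments being lengthened at the missing edges.

  Lower bound: the image of a (k j - 1)-wiring of block j of X with small volume meets at most one
  column of Y, so it lies in a tree.  Each edge of this tree separates block j along fewer than k j
  edges, so one side of the cut meets few columns, and some vertex of the tree has only such
  sides around it.  These are too few to contain all the columns of block j.
*)

theory Submission
  imports Defs Complex_Main "HOL-Library.Discrete_Functions" "HOL-Library.Nat_Bijection"
begin

section \<open>Paths and edge cuts under wirings\<close>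

lemma int_interval_const:
  fixes P :: "int \<Rightarrow> bool"
  assumes "\<And>t. a \<le> t \<Longrightarrow> t < b \<Longrightarrow> P t \<longleftrightarrow> P (t + 1)"
    and "t \<in> {a..b}" "u \<in> {a..b}"
  shows "P t \<longleftrightarrow> P u"
proof -
  have *: "v \<le> b \<longrightarrow> (P v \<longleftrightarrow> P a)" if "a \<le> v" for v
    using that by (induction v rule: int_ge_induct) (use assms(1) in auto)
  show ?thesis using *[of t] *[of u] assms(2,3) by simp
qed

lemma path_const:
  assumes "\<And>d. d \<in> path_edges xs \<Longrightarrow> d \<subseteq> P \<or> d \<inter> P = {}"
    and "u \<in> set xs" "v \<in> set xs"
  shows "u \<in> P \<longleftrightarrow> v \<in> P"
proof -
  have *: "i < length xs \<longrightarrow> (xs ! i \<in> P \<longleftrightarrow> xs ! 0 \<in> P)" for i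
  proof (induction i)
    case (Suc i)
    show ?case
    proof
      assume i: "Suc i < length xs"
      then have "{xs ! i, xs ! Suc i} \<in> path_edges xs" by (auto simp: path_edges_def)
      from assms(1)[OF this] Suc i show "xs ! Suc i \<in> P \<longleftrightarrow> xs ! 0 \<in> P" by auto
    qed
  qed auto
  obtain i j where "i < length xs" "u = xs ! i" "j < length xs" "v = xs ! j"
    using assms(2,3) by (auto simp: in_set_conv_nth)
  then show ?thesis using *[of i] *[of j] by simp
qed

text \<open>The edge cut between \<open>A\<close> and its complement. Edges are sets, so having ends
  on both sides is expressed without naming the ends.\<close>

definition boundary :: "'a graph \<Rightarrow> 'a set \<Rightarrow> 'a set set" where
  "boundary G A = {e \<in> edges G. \<not> e \<subseteq> A \<and> e \<inter> A \<noteq> {}}"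

lemma boundary_Compl:
  assumes "\<And>e. e \<in> edges G \<Longrightarrow> e \<noteq> {}"
  shows "boundary G (- A) = boundary G A"
  unfolding boundary_def by auto

lemma is_wiring_endpoints:
  assumes "is_wiring G Y f p" "e \<in> edges G" "v \<in> e"
  shows "f v \<in> set (p e)"
proof -
  have "is_path Y (p e)" and "{hd (p e), last (p e)} = f ` e"
    using assms by (auto simp: is_wiring_def)
  then have "f v = hd (p e) \<or> f v = last (p e)" and "p e \<noteq> []"
    using assms(3) by (auto simp: is_path_def)
  then show ?thesis by auto
qed

lemma is_wiring_path_edges:
  assumes "is_wiring G Y f p" "e \<in> edges G" "d \<in> path_edges (p e)"
  shows "d \<in> edges Y" "d \<subseteq> image_verts G f p"
  using assms by (auto simp: is_wiring_def is_path_def path_edges_def image_verts_def)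

text \<open>If the ends of \<open>e\<close> land on different sides of \<open>P\<close>, the path of
  \<open>e\<close> has to cross between \<open>P\<close> and its complement, and only at
  \<open>d\<close> may a path do so. Taking for \<open>d\<close> a set that is no edge covers the
  case without any crossing.\<close>

lemma wiring_boundary_subset:
  assumes w: "is_wiring G Y f p"
    and cut: "\<And>e d'. e \<in> edges G \<Longrightarrow> d' \<in> path_edges (p e) \<Longrightarrow> d' \<noteq> d \<Longrightarrow> d' \<subseteq> P \<or> d' \<inter> P = {}"
  shows "boundary G (f -` P) \<subseteq> {e \<in> edges G. d \<in> path_edges (p e)}"
proof
  fix e assume "e \<in> boundary G (f -` P)"
  then obtain u v where e: "e \<in> edges G" "u \<in> e" "v \<in> e" "f u \<in> P" "f v \<notin> P"
    by (auto simp: boundary_def)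
  have "d \<in> path_edges (p e)"
  proof (rule ccontr)
    assume "d \<notin> path_edges (p e)"
    then have "f u \<in> P \<longleftrightarrow> f v \<in> P"
      using cut[OF e(1)] e by (intro path_const[of "p e"] is_wiring_endpoints[OF w]) auto
    with e show False by auto
  qed
  with e show "e \<in> {e \<in> edges G. d \<in> path_edges (p e)}" by auto
qed

text \<open>All edges of \<open>G\<close> cut by the preimage of \<open>P\<close> run through the
  single edge \<open>d\<close>, whose load is at most \<open>K\<close>. If \<open>d\<close> is no
  edge of \<open>Y\<close>, no path uses it and the cut is empty.\<close>

lemma coarse_wiring_boundary:
  assumes cw: "coarse_wiring K G Y f p" and fin: "finite (edges G)"
    and cut: "\<And>e d'. e \<in> edges G \<Longrightarrow> d' \<in> path_edges (p e) \<Longrightarrow> d' \<noteq> d \<Longrightarrow> d' \<subseteq> P \<or> d' \<inter> P = {}"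
  shows "card (boundary G (f -` P)) \<le> K"
proof -
  have w: "is_wiring G Y f p" using cw by (simp add: coarse_wiring_def)
  have sub: "boundary G (f -` P) \<subseteq> {e \<in> edges G. d \<in> path_edges (p e)}"
    using w cut by (rule wiring_boundary_subset)
  show ?thesis
  proof (cases "d \<in> edges Y")
    case True
    then have "card {e \<in> edges G. d \<in> path_edges (p e)} \<le> K"
      using cw by (auto simp: coarse_wiring_def)
    moreover have "card (boundary G (f -` P)) \<le> card {e \<in> edges G. d \<in> path_edges (p e)}"
      by (rule card_mono[OF _ sub]) (use fin in auto)
    ultimately show ?thesis by simp
  next
    case False
    then have "boundary G (f -` P) = {}"
      using sub is_wiring_path_edges(1)[OF w] by blast
    then show ?thesis by simp
  qed
qed

lemma coarse_wiring_card_le: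
  assumes cw: "coarse_wiring K G Y f p" and "finite W" "W \<subseteq> verts Y" "f ` verts G \<subseteq> W"
    "finite (verts G)"
  shows "card (verts G) \<le> K * card W"
proof -
  have "card (verts G) = card (\<Union>w\<in>W. {v \<in> verts G. f v = w})"
    using assms by (intro arg_cong[where f = card]) auto
  also have "\<dots> \<le> (\<Sum>w\<in>W. card {v \<in> verts G. f v = w})"
    using assms by (intro card_UN_le) auto
  also have "\<dots> \<le> (\<Sum>w\<in>W. K)"
    using assms by (intro sum_mono) (auto simp: coarse_wiring_def)
  finally show ?thesis by (simp add: mult.commute)
qed

section \<open>Ladder graphs and their blocks\<close>

text \<open>Recovering the block index from a row through \<open>blk\<close> encodes that different
  blocks have disjoint ranges of rows.\<close>

locale ladders =
  fixes k :: "nat \<Rightarrow> nat" and base :: "nat \<Rightarrow> int" and blk :: "int \<Rightarrow> nat"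
  assumes k_ge: "2 \<le> k j"
    and blk_eq: "base j \<le> y \<Longrightarrow> y < base j + int (k j) \<Longrightarrow> blk y = j"
begin

definition rows :: "nat \<Rightarrow> int set" where
  "rows j = {base j..<base j + int (k j)}"

text \<open>The factor 5 belongs to the lower bound, where the columns would be covered by five sets
  that meet fewer than \<open>k j\<close> of them each.\<close>

definition width :: "(nat \<Rightarrow> nat) \<Rightarrow> nat \<Rightarrow> int" where
  "width \<sigma> j = int (5 * k j) * int (\<sigma> j)"

definition block :: "(nat \<Rightarrow> nat) \<Rightarrow> nat \<Rightarrow> (int \<times> int) graph" where
  "block \<sigma> j = ({0..width \<sigma> j} \<times> rows j,
     {{(x, y), (x + 1, y)} | x y. y \<in> rows j \<and> 0 \<le> x \<and> x < width \<sigma> j} \<union>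
     {{(x, y), (x, y + 1)} | x y. y \<in> rows j \<and> y + 1 \<in> rows j \<and>
        0 \<le> x \<and> x \<le> width \<sigma> j \<and> int (\<sigma> j) dvd x})"

definition lad :: "(nat \<Rightarrow> nat) \<Rightarrow> (int \<times> int) graph" where
  "lad \<sigma> = (\<Union>j. verts (block \<sigma> j), \<Union>j. edges (block \<sigma> j))"

lemma verts_block: "verts (block \<sigma> j) = {0..width \<sigma> j} \<times> rows j"
  by (simp add: block_def verts_def)

lemma verts_lad: "verts (lad \<sigma>) = (\<Union>j. verts (block \<sigma> j))"
  and edges_lad: "edges (lad \<sigma>) = (\<Union>j. edges (block \<sigma> j))"
  by (simp_all add: lad_def verts_def edges_def)

lemma edges_blockE:
  assumes "e \<in> edges (block \<sigma> j)"
  obtains (hor) x y where "e = {(x, y), (x + 1, y)}" "y \<in> rows j" "0 \<le> x" "x < width \<sigma> j"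
  | (ver) x y where "e = {(x, y), (x, y + 1)}" "y \<in> rows j" "y + 1 \<in> rows j"
      "0 \<le> x" "x \<le> width \<sigma> j" "int (\<sigma> j) dvd x"
  using assms unfolding block_def edges_def by auto

lemma hor_edge: "y \<in> rows j \<Longrightarrow> 0 \<le> x \<Longrightarrow> x < width \<sigma> j \<Longrightarrow>
    {(x, y), (x + 1, y)} \<in> edges (block \<sigma> j)"
  unfolding block_def edges_def by auto

lemma ver_edge: "y \<in> rows j \<Longrightarrow> y + 1 \<in> rows j \<Longrightarrow> 0 \<le> x \<Longrightarrow> x \<le> width \<sigma> j \<Longrightarrow>
    int (\<sigma> j) dvd x \<Longrightarrow> {(x, y), (x, y + 1)} \<in> edges (block \<sigma> j)"
  unfolding block_def edges_def by auto

lemma rows_blk: "y \<in> rows j \<Longrightarrow> blk y = j"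
  using blk_eq by (auto simp: rows_def)

lemma finite_rows: "finite (rows j)" and card_rows: "card (rows j) = k j"
  by (auto simp: rows_def)

lemma base_in_rows: "base j \<in> rows j"
  using k_ge[of j] by (auto simp: rows_def)

lemma width_nonneg: "0 \<le> width \<sigma> j"
  by (simp add: width_def)

lemma card_verts_block: "card (verts (block \<sigma> j)) = k j * (5 * k j * \<sigma> j + 1)"
proof -
  have "nat (width \<sigma> j + 1) = 5 * k j * \<sigma> j + 1"
    unfolding width_def by (metis of_nat_1 of_nat_add of_nat_mult nat_int)
  then show ?thesis by (simp add: verts_block card_cartesian_product card_rows)
qed

lemma finite_verts_block: "finite (verts (block \<sigma> j))"
  by (simp add: verts_block finite_rows)

lemma edges_block_subset: "e \<in> edges (block \<sigma> j) \<Longrightarrow> e \<subseteq> verts (block \<sigma> j) \<and> e \<noteq> {}"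
  by (elim edges_blockE) (auto simp: verts_block)

lemma finite_edges_block: "finite (edges (block \<sigma> j))"
  using finite_verts_block[of \<sigma> j] edges_block_subset[of _ \<sigma> j]
  by (meson PowI finite_Pow_iff finite_subset subsetI)

lemma wf_block: "wf_graph (block \<sigma> j)"
  unfolding wf_graph_def
proof
  fix e assume e: "e \<in> edges (block \<sigma> j)"
  then have "\<exists>u v. u \<noteq> v \<and> e = {u, v}"
  proof (cases rule: edges_blockE)
    case (hor x y)
    then show ?thesis by (intro exI[of _ "(x, y)"] exI[of _ "(x + 1, y)"]) auto
  next
    case (ver x y)
    then show ?thesis by (intro exI[of _ "(x, y)"] exI[of _ "(x, y + 1)"]) auto
  qed
  with edges_block_subset[OF e]
  show "\<exists>u v. u \<noteq> v \<and> e = {u, v} \<and> u \<in> verts (block \<sigma> j) \<and> v \<in> verts (block \<sigma> j)"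
    by blast
qed

lemma subgraph_block_lad: "subgraph (block \<sigma> j) (lad \<sigma>)"
  using wf_block by (auto simp: subgraph_def verts_lad edges_lad)

lemma subgraph_lad_grid: "subgraph (lad \<sigma>) grid2"
proof -
  have "wf_graph (lad \<sigma>)"
    unfolding wf_graph_def
  proof
    fix e assume "e \<in> edges (lad \<sigma>)"
    then obtain j where "e \<in> edges (block \<sigma> j)" by (auto simp: edges_lad)
    then obtain u v where "u \<noteq> v \<and> e = {u, v} \<and> u \<in> verts (block \<sigma> j) \<and> v \<in> verts (block \<sigma> j)"
      using wf_block[of \<sigma> j] unfolding wf_graph_def by blast
    then show "\<exists>u v. u \<noteq> v \<and> e = {u, v} \<and> u \<in> verts (lad \<sigma>) \<and> v \<in> verts (lad \<sigma>)"
      unfolding verts_lad by blast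
  qed
  moreover have "edges (lad \<sigma>) \<subseteq> edges grid2"
  proof
    have grid: "{p, q} \<in> edges grid2" if "\<bar>fst p - fst q\<bar> + \<bar>snd p - snd q\<bar> = 1" for p q
      using that unfolding grid2_def edges_def snd_conv by blast
    fix e assume "e \<in> edges (lad \<sigma>)"
    then obtain j where "e \<in> edges (block \<sigma> j)" by (auto simp: edges_lad)
    then show "e \<in> edges grid2"
    proof (cases rule: edges_blockE)
      case (hor x y)
      then show ?thesis by (simp add: grid)
    next
      case (ver x y)
      then show ?thesis by (simp add: grid)
    qed
  qed
  moreover have "verts grid2 = UNIV" by (simp add: grid2_def verts_def)
  ultimately show ?thesis by (simp add: subgraph_def)
qed

section \<open>Columns met by one side of a small cut\<close>

text \<open>Columns are represented by their x-coordinates. One vertex in \<open>A\<close> suffices,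
  so a column may count both for \<open>A\<close> and for its complement, and the count is
  subadditive in \<open>A\<close>.\<close>

definition cols :: "(nat \<Rightarrow> nat) \<Rightarrow> nat \<Rightarrow> (int \<times> int) set \<Rightarrow> int set" where
  "cols \<sigma> j A = {x \<in> {0..width \<sigma> j}. int (\<sigma> j) dvd x \<and> (\<exists>y\<in>rows j. (x, y) \<in> A)}"

lemma finite_cols: "finite (cols \<sigma> j A)"
  by (rule finite_subset[of _ "{0..width \<sigma> j}"]) (auto simp: cols_def)

lemma card_cols_UNIV:
  assumes "0 < \<sigma> j"
  shows "5 * k j < card (cols \<sigma> j UNIV)"
proof -
  have "card ((\<lambda>c. int (c * \<sigma> j)) ` {0..5 * k j}) = 5 * k j + 1"
    using assms by (subst card_image) (auto simp: inj_on_def)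
  moreover have "(\<lambda>c. int (c * \<sigma> j)) ` {0..5 * k j} \<subseteq> cols \<sigma> j UNIV"
  proof
    fix x assume "x \<in> (\<lambda>c. int (c * \<sigma> j)) ` {0..5 * k j}"
    then obtain c where c: "x = int (c * \<sigma> j)" "c \<le> 5 * k j"
      using atLeastAtMost_iff by blast
    then have "x \<le> width \<sigma> j" unfolding width_def by (metis mult_le_mono1 of_nat_le_iff of_nat_mult)
    with c show "x \<in> cols \<sigma> j UNIV" using base_in_rows by (auto simp: cols_def)
  qed
  ultimately show ?thesis using card_mono[OF finite_cols] by (metis Suc_eq_plus1 Suc_le_eq)
qed

lemma cols_Un: "cols \<sigma> j (A \<union> B) = cols \<sigma> j A \<union> cols \<sigma> j B"
  by (auto simp: cols_def)

lemma card_cols_Un: "card (cols \<sigma> j (A \<union> B)) \<le> card (cols \<sigma> j A) + card (cols \<sigma> j B)"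
  unfolding cols_Un by (rule card_Un_le)

lemma card_cols_le: "card (cols \<sigma> j A) \<le> card (A \<inter> verts (block \<sigma> j))"
proof -
  have "cols \<sigma> j A \<subseteq> fst ` (A \<inter> verts (block \<sigma> j))"
    by (force simp: cols_def verts_block)
  then show ?thesis
    using finite_verts_block by (meson card_image_le card_mono finite_Int finite_imageI le_trans)
qed

text \<open>A column that meets \<open>A\<close> also meets the row \<open>y0\<close>, which avoids
  \<open>A\<close>, so one of its vertical edges is cut. Different columns yield different cut
  edges.\<close>

lemma card_cols_le_boundary_aux:
  assumes row: "y0 \<in> rows j" "\<And>x. x \<in> {0..width \<sigma> j} \<Longrightarrow> (x, y0) \<notin> A"
  shows "card (cols \<sigma> j A) \<le> card (boundary (block \<sigma> j) A)"
proof -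
  have "\<exists>y. {(x, y), (x, y + 1)} \<in> boundary (block \<sigma> j) A" if x: "x \<in> cols \<sigma> j A" for x
  proof (rule ccontr)
    assume no: "\<nexists>y. {(x, y), (x, y + 1)} \<in> boundary (block \<sigma> j) A"
    obtain y1 where y1: "y1 \<in> rows j" "(x, y1) \<in> A" using x by (auto simp: cols_def)
    have "(x, y) \<in> A \<longleftrightarrow> (x, y + 1) \<in> A" if "base j \<le> y" "y < base j + int (k j) - 1" for y
    proof -
      have "{(x, y), (x, y + 1)} \<in> edges (block \<sigma> j)"
        using x that by (intro ver_edge) (auto simp: cols_def rows_def)
      with no show ?thesis by (auto simp: boundary_def)
    qed
    from int_interval_const[of "base j" "base j + int (k j) - 1" "\<lambda>y. (x, y) \<in> A", OF this, of y1 y0]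
    have "(x, y0) \<in> A" using y1 row by (auto simp: rows_def)
    moreover have "x \<in> {0..width \<sigma> j}" using x by (auto simp: cols_def)
    ultimately show False using row by auto
  qed
  then obtain g where g: "\<And>x. x \<in> cols \<sigma> j A \<Longrightarrow> {(x, g x), (x, g x + 1)} \<in> boundary (block \<sigma> j) A"
    by metis
  show ?thesis
  proof (rule card_inj_on_le[of "\<lambda>x. {(x, g x), (x, g x + 1)}"])
    show "inj_on (\<lambda>x. {(x, g x), (x, g x + 1)}) (cols \<sigma> j A)"
      by (auto simp: inj_on_def doubleton_eq_iff)
    show "finite (boundary (block \<sigma> j) A)" using finite_edges_block by (auto simp: boundary_def)
  qed (use g in auto)
qed

lemma boundary_block_Compl: "boundary (block \<sigma> j) (- A) = boundary (block \<sigma> j) A"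
  using edges_block_subset by (intro boundary_Compl) auto

text \<open>Some row is not cut by a small boundary, so every column meeting the other side is cut.\<close>

lemma card_cols_le_boundary:
  assumes "card (boundary (block \<sigma> j) A) < k j"
  shows "card (cols \<sigma> j A) \<le> card (boundary (block \<sigma> j) A) \<or>
         card (cols \<sigma> j (- A)) \<le> card (boundary (block \<sigma> j) A)"
proof -
  have "\<exists>y\<in>rows j. \<forall>x. {(x, y), (x + 1, y)} \<notin> boundary (block \<sigma> j) A"
  proof (rule ccontr)
    assume "\<not> ?thesis"
    then obtain g where g: "\<And>y. y \<in> rows j \<Longrightarrow> {(g y, y), (g y + 1, y)} \<in> boundary (block \<sigma> j) A"
      by metis
    have "card (rows j) \<le> card (boundary (block \<sigma> j) A)"
    proof (rule card_inj_on_le[of "\<lambda>y. {(g y, y), (g y + 1, y)}"])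
      show "inj_on (\<lambda>y. {(g y, y), (g y + 1, y)}) (rows j)"
        by (auto simp: inj_on_def doubleton_eq_iff)
      show "finite (boundary (block \<sigma> j) A)" using finite_edges_block by (auto simp: boundary_def)
    qed (use g in auto)
    with assms show False by (simp add: card_rows)
  qed
  then obtain y0 where y0: "y0 \<in> rows j" "\<And>x. {(x, y0), (x + 1, y0)} \<notin> boundary (block \<sigma> j) A"
    by auto
  have step: "(x, y0) \<in> A \<longleftrightarrow> (x + 1, y0) \<in> A" if "0 \<le> x" "x < width \<sigma> j" for x
    using y0(2)[of x] hor_edge[OF y0(1) that] by (auto simp: boundary_def)
  have const: "(x, y0) \<in> A \<longleftrightarrow> (0, y0) \<in> A" if "x \<in> {0..width \<sigma> j}" for x
    using int_interval_const[of 0 "width \<sigma> j" "\<lambda>x. (x, y0) \<in> A", OF step, of x 0] that width_nonneg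
    by auto
  show ?thesis
  proof (cases "(0, y0) \<in> A")
    case True
    then have "card (cols \<sigma> j (- A)) \<le> card (boundary (block \<sigma> j) (- A))"
      using const y0(1) by (intro card_cols_le_boundary_aux[of y0]) auto
    then show ?thesis by (simp add: boundary_block_Compl)
  next
    case False
    then show ?thesis
      using const y0(1) by (intro disjI1 card_cols_le_boundary_aux[of y0]) auto
  qed
qed

section \<open>Connectivity of a block and of its image\<close>

text \<open>Every vertex is joined to the corner \<open>(0, base j)\<close>: along its row to
  x-coordinate 0, which is always a column, and then down that column.\<close>

lemma block_connected:
  assumes "boundary (block \<sigma> j) A = {}" and u: "u \<in> verts (block \<sigma> j)" and v: "v \<in> verts (block \<sigma> j)"
  shows "u \<in> A \<longleftrightarrow> v \<in> A"
proof -
  have *: "(x, y) \<in> A \<longleftrightarrow> (0, base j) \<in> A" if xy: "(x, y) \<in> verts (block \<sigma> j)" for x y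
  proof -
    have "(t, y) \<in> A \<longleftrightarrow> (t + 1, y) \<in> A" if "0 \<le> t" "t < width \<sigma> j" for t
      using hor_edge[of y j t \<sigma>] that xy assms(1) by (auto simp: boundary_def verts_block)
    from int_interval_const[of 0 "width \<sigma> j" "\<lambda>x. (x, y) \<in> A", OF this, of x 0]
    have 1: "(x, y) \<in> A \<longleftrightarrow> (0, y) \<in> A" using xy by (auto simp: verts_block)
    have "(0, t) \<in> A \<longleftrightarrow> (0, t + 1) \<in> A" if "base j \<le> t" "t < base j + int (k j) - 1" for t
      using ver_edge[of t j 0 \<sigma>] that xy assms(1)
      by (auto simp: boundary_def verts_block rows_def)
    from int_interval_const[of "base j" "base j + int (k j) - 1" "\<lambda>t. (0, t) \<in> A", OF this, of y "base j"]
    have "(0, y) \<in> A \<longleftrightarrow> (0, base j) \<in> A" using xy by (auto simp: verts_block rows_def)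
    with 1 show ?thesis by simp
  qed
  show ?thesis using *[of "fst u" "snd u"] *[of "fst v" "snd v"] u v by simp
qed

text \<open>Connectivity of the image, phrased by cuts: a set that no path edge crosses contains all
  of the image or none of it.\<close>

lemma image_block_connected:
  assumes w: "is_wiring (block \<sigma> j) Y f p"
    and cut: "\<And>e d. e \<in> edges (block \<sigma> j) \<Longrightarrow> d \<in> path_edges (p e) \<Longrightarrow> d \<subseteq> P \<or> d \<inter> P = {}"
    and u: "u \<in> image_verts (block \<sigma> j) f p" and v: "v \<in> image_verts (block \<sigma> j) f p"
  shows "u \<in> P \<longleftrightarrow> v \<in> P"
proof -
  \<comment> \<open>The exceptional edge is taken to be \<open>{}\<close>, which never occurs on a
    path, so the cut is empty.\<close>
  have "boundary (block \<sigma> j) (f -` P) \<subseteq> {e \<in> edges (block \<sigma> j). {} \<in> path_edges (p e)}"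
    using w cut by (rule wiring_boundary_subset)
  then have "boundary (block \<sigma> j) (f -` P) = {}" by (auto simp: path_edges_def)
  note conn = block_connected[OF this]
  have "\<exists>q\<in>verts (block \<sigma> j). z \<in> P \<longleftrightarrow> f q \<in> P" if "z \<in> image_verts (block \<sigma> j) f p" for z
  proof (cases "z \<in> f ` verts (block \<sigma> j)")
    case False
    then obtain e where e: "e \<in> edges (block \<sigma> j)" "z \<in> set (p e)"
      using \<open>z \<in> _\<close> by (auto simp: image_verts_def)
    obtain q where q: "q \<in> e" "q \<in> verts (block \<sigma> j)" using edges_block_subset[OF e(1)] by auto
    have "z \<in> P \<longleftrightarrow> f q \<in> P"
      using cut[OF e(1)] e(2) is_wiring_endpoints[OF w e(1) q(1)] by (rule path_const)
    with q show ?thesis by auto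
  qed auto
  with u v obtain q r where "q \<in> verts (block \<sigma> j)" "r \<in> verts (block \<sigma> j)"
    "u \<in> P \<longleftrightarrow> f q \<in> P" "v \<in> P \<longleftrightarrow> f r \<in> P" by metis
  with conn[of q r] show ?thesis by simp
qed

lemma edge_lad_in_block:
  assumes "d \<in> edges (lad \<sigma>)" "v \<in> d" "v \<in> verts (block \<sigma> i)"
  shows "d \<in> edges (block \<sigma> i)"
proof -
  obtain i' where i': "d \<in> edges (block \<sigma> i')" using assms(1) by (auto simp: edges_lad)
  then have "v \<in> verts (block \<sigma> i')" using edges_block_subset assms(2) by blast
  with assms(3) have "i' = i" using rows_blk by (auto simp: verts_block)
  with i' show ?thesis by simp
qed

section \<open>Lower bound: wirings with load below the number of rows\<close>

text \<open>The image is connected, so it stays in one block \<open>i\<close>. An earlier block has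
  at most as many vertices as one row of the source block, and fibres of size at most
  \<open>k j - 1\<close> cannot hold \<open>k j\<close> rows there.\<close>

lemma image_in_one_block:
  assumes cw: "coarse_wiring (k j - 1) (block s j) (lad S) f p"
    and small: "\<And>i. i < j \<Longrightarrow> card (verts (block S i)) \<le> 5 * k j * s j + 1"
  obtains i where "j \<le> i" "image_verts (block s j) f p \<subseteq> verts (block S i)"
    "\<forall>e\<in>edges (block s j). path_edges (p e) \<subseteq> edges (block S i)"
proof -
  let ?G = "block s j" and ?im = "image_verts (block s j) f p"
  have w: "is_wiring ?G (lad S) f p" using cw by (simp add: coarse_wiring_def)
  have o: "(0, base j) \<in> verts ?G" using base_in_rows width_nonneg by (auto simp: verts_block)
  then have fo: "f (0, base j) \<in> ?im" by (auto simp: image_verts_def)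
  have "f (0, base j) \<in> verts (lad S)" using w o by (auto simp: is_wiring_def)
  then obtain i where i: "f (0, base j) \<in> verts (block S i)" by (auto simp: verts_lad)
  have cut: "d \<subseteq> verts (block S i) \<or> d \<inter> verts (block S i) = {}"
    if "e \<in> edges ?G" "d \<in> path_edges (p e)" for e d
    using edge_lad_in_block[OF is_wiring_path_edges(1)[OF w that]] edges_block_subset by blast
  have im: "?im \<subseteq> verts (block S i)"
  proof
    fix u assume "u \<in> ?im"
    from w cut this fo have "u \<in> verts (block S i) \<longleftrightarrow> f (0, base j) \<in> verts (block S i)"
      by (rule image_block_connected)
    with i show "u \<in> verts (block S i)" by simp
  qed
  have "j \<le> i"
  proof (rule ccontr)
    assume "\<not> j \<le> i"
    have "card (verts ?G) \<le> (k j - 1) * card (verts (block S i))"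
      using im finite_verts_block
      by (intro coarse_wiring_card_le[OF cw]) (auto simp: verts_lad image_verts_def)
    also have "\<dots> \<le> (k j - 1) * (5 * k j * s j + 1)"
      using small[of i] \<open>\<not> j \<le> i\<close> by (intro mult_left_mono) auto
    also have "\<dots> < k j * (5 * k j * s j + 1)"
      using k_ge[of j] by (intro mult_strict_right_mono) auto
    finally show False by (simp add: card_verts_block)
  qed
  moreover have "d \<in> edges (block S i)" if "e \<in> edges ?G" "d \<in> path_edges (p e)" for e d
  proof -
    have d: "d \<in> edges (lad S)" "d \<subseteq> verts (block S i)"
      using is_wiring_path_edges[OF w that] im by auto
    moreover have "d \<noteq> {}" using that(2) by (auto simp: path_edges_def)
    ultimately show ?thesis using edge_lad_in_block by blast
  qed
  ultimately show thesis using im that[of i] by blast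
qed

text \<open>Since the columns of the target are further apart than the image is wide, the image lies
  in a double comb, whose spine is the column at m.\<close>

lemma image_in_comb:
  assumes w: "is_wiring (block s j) Y f p"
    and im: "image_verts (block s j) f p \<subseteq> verts (block S i)"
    and edges_im: "\<forall>e\<in>edges (block s j). path_edges (p e) \<subseteq> edges (block S i)"
    and card_im: "card (image_verts (block s j) f p) < S i"
  obtains m where
    "\<forall>v\<in>image_verts (block s j) f p. \<bar>fst v - m\<bar> < int (S i)"
    "\<forall>e\<in>edges (block s j). \<forall>d\<in>path_edges (p e).
       (\<exists>x y. d = {(x, y), (x + 1, y)}) \<or> (\<exists>y. d = {(m, y), (m, y + 1)})"
proof -
  let ?im = "image_verts (block s j) f p"
  define X where "X = fst ` ?im"
  have fin: "finite ?im" using im finite_verts_block finite_subset by blast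
  have "f (0, base j) \<in> ?im"
    using base_in_rows width_nonneg by (auto simp: image_verts_def verts_block)
  then have X: "finite X" "X \<noteq> {}" using fin by (auto simp: X_def)
  have d_im: "d \<subseteq> ?im" if "e \<in> edges (block s j)" "d \<in> path_edges (p e)" for e d
    using is_wiring_path_edges[OF w that] by simp
  have convex: "x \<in> X" if x: "a \<in> X" "b \<in> X" "a \<le> x" "x \<le> b" for a b x
  proof (rule ccontr)
    assume "x \<notin> X"
    obtain u v where uv: "u \<in> ?im" "v \<in> ?im" "a = fst u" "b = fst v" using x by (auto simp: X_def)
    \<comment> \<open>A horizontal edge crossing to x-coordinate \<open>x\<close> would end in the
      image at \<open>x\<close>, so an unattained \<open>x\<close> separates the image.\<close>
    have cut: "d \<subseteq> {v. fst v < x} \<or> d \<inter> {v. fst v < x} = {}"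
      if ed: "e \<in> edges (block s j)" "d \<in> path_edges (p e)" for e d
      using subsetD[OF bspec[OF edges_im ed(1)] ed(2)]
    proof (cases rule: edges_blockE)
      case (hor x' y)
      then have "x' + 1 \<in> X" using d_im[OF ed] by (force simp: X_def)
      with \<open>x \<notin> X\<close> have "x' + 1 \<noteq> x" by auto
      with hor show ?thesis by auto
    qed auto
    from w cut uv(1,2) have "u \<in> {v. fst v < x} \<longleftrightarrow> v \<in> {v. fst v < x}"
      by (rule image_block_connected)
    then have "a < x \<longleftrightarrow> b < x" using uv by simp
    with x \<open>x \<notin> X\<close> show False by (cases "a = x") auto
  qed
  have "{Min X..Max X} \<subseteq> X"
    using convex[OF Min_in[OF X] Max_in[OF X]] by auto
  from card_mono[OF X(1) this] have "nat (Max X - Min X + 1) \<le> card X" by simp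
  also have "\<dots> \<le> card ?im" unfolding X_def by (rule card_image_le[OF fin])
  finally have diam: "Max X - Min X + 1 < int (S i)" using card_im by linarith
  \<comment> \<open>The last multiple of the target spacing that is at most \<open>Max X\<close>.
    The image is narrower than the spacing, so every other multiple is out of its reach.\<close>
  define m where "m = (Max X div int (S i)) * int (S i)"
  have m: "m \<le> Max X" "Max X < m + int (S i)"
    using card_im by (auto simp: m_def div_mult_mod_eq minus_mod_eq_div_mult[symmetric])
  have near: "\<bar>fst v - m\<bar> < int (S i)" if "v \<in> ?im" for v
  proof -
    have "fst v \<in> X" using that by (auto simp: X_def)
    then have "Min X \<le> fst v" "fst v \<le> Max X" using X by auto
    with m diam show ?thesis by linarith
  qed
  have "(\<exists>x y. d = {(x, y), (x + 1, y)}) \<or> (\<exists>y. d = {(m, y), (m, y + 1)})"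
    if ed: "e \<in> edges (block s j)" "d \<in> path_edges (p e)" for e d
    using subsetD[OF bspec[OF edges_im ed(1)] ed(2)]
  proof (cases rule: edges_blockE)
    case (ver x y)
    then have "\<bar>x - m\<bar> < int (S i)" using near[of "(x, y)"] d_im[OF ed] by auto
    moreover have "int (S i) dvd x - m" using ver by (auto simp: m_def)
    ultimately have "x = m" using zdvd_imp_le[of "int (S i)" "\<bar>x - m\<bar>"] by auto
    with ver show ?thesis by auto
  qed auto
  with near that[of m] show thesis by blast
qed

text \<open>A comb is a tree and each of its edges cuts off a part whose preimage, or that of its
  complement, meets fewer than k j columns; following the large sides leads to a vertex whose
  branches are all small, but five such parts do not exhaust the columns.\<close>

lemma vol_wiring_ge:
  assumes cw: "coarse_wiring (k j - 1) (block s j) (lad S) f p"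
    and s: "0 < s j"
    and small: "\<And>i. i < j \<Longrightarrow> card (verts (block S i)) \<le> 5 * k j * s j + 1"
    and large: "\<And>i. j \<le> i \<Longrightarrow> N \<le> S i"
  shows "N \<le> vol (block s j) f p"
proof (rule ccontr)
  assume "\<not> ?thesis"
  let ?G = "block s j" and ?im = "image_verts (block s j) f p"
  have w: "is_wiring ?G (lad S) f p" using cw by (simp add: coarse_wiring_def)
  obtain i where i: "j \<le> i" and im: "?im \<subseteq> verts (block S i)"
    and edges_im: "\<forall>e\<in>edges ?G. path_edges (p e) \<subseteq> edges (block S i)"
    using image_in_one_block[of j s S f p, OF cw small] by blast
  have card_im: "card ?im < S i" using \<open>\<not> _\<close> large[OF i] by (simp add: vol_def)
  obtain m where near: "\<forall>v\<in>?im. \<bar>fst v - m\<bar> < int (S i)"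
    and comb: "\<forall>e\<in>edges ?G. \<forall>d\<in>path_edges (p e).
       (\<exists>x y. d = {(x, y), (x + 1, y)}) \<or> (\<exists>y. d = {(m, y), (m, y + 1)})"
    using image_in_comb[OF w im edges_im card_im] by blast
  define sm where "sm P \<longleftrightarrow> card (cols s j (f -` P)) < k j" for P
  \<comment> \<open>The comb is taken infinite: all horizontal lines and the vertical line at
    \<open>m\<close>. The assumptions say that \<open>d\<close> is its only edge that may cross
    \<open>P\<close>, so the cut in the block has at most \<open>k j - 1\<close> edges.\<close>
  have sm_cut: "sm P \<or> sm (- P)"
    if hor: "\<And>x y. {(x, y), (x + 1, y)} \<noteq> d \<Longrightarrow> (x, y) \<in> P \<longleftrightarrow> (x + 1, y) \<in> P"
      and ver: "\<And>y. {(m, y), (m, y + 1)} \<noteq> d \<Longrightarrow> (m, y) \<in> P \<longleftrightarrow> (m, y + 1) \<in> P" for P d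
  proof -
    have cut: "d' \<subseteq> P \<or> d' \<inter> P = {}" if "e \<in> edges ?G" "d' \<in> path_edges (p e)" "d' \<noteq> d" for e d'
    proof -
      from comb that(1,2) consider x y where "d' = {(x, y), (x + 1, y)}" | y where "d' = {(m, y), (m, y + 1)}"
        by blast
      then show ?thesis
      proof cases
        case (1 x y)
        with hor[of x y] that(3) show ?thesis by auto
      next
        case (2 y)
        with ver[of y] that(3) show ?thesis by auto
      qed
    qed
    have "card (boundary ?G (f -` P)) \<le> k j - 1"
      using cw finite_edges_block cut by (rule coarse_wiring_boundary)
    then have "card (boundary ?G (f -` P)) < k j" using k_ge[of j] by linarith
    then show ?thesis
      using card_cols_le_boundary[of s j "f -` P"] unfolding sm_def vimage_Compl by linarith
  qed
  \<comment> \<open>Five small sets meet at most \<open>5 * (k j - 1)\<close> columns, but there are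
    more than \<open>5 * k j\<close>.\<close>
  have sm_cover: "A \<union> B \<union> C \<union> D \<union> E \<noteq> UNIV" if "sm A" "sm B" "sm C" "sm D" "sm E" for A B C D E
  proof
    assume *: "A \<union> B \<union> C \<union> D \<union> E = UNIV"
    let ?c = "\<lambda>P. card (cols s j (f -` P))"
    have "?c (A \<union> B \<union> C \<union> D \<union> E) \<le> ?c A + ?c B + ?c C + ?c D + ?c E"
      unfolding vimage_Un
      by (intro order_trans[OF card_cols_Un] add_mono order_refl)
    then show False
      using card_cols_UNIV[of s j, OF s] that unfolding * sm_def by simp
  qed
  \<comment> \<open>A fibre has at most \<open>k j - 1\<close> vertices, hence meets at most that
    many columns. Off the target graph it is empty.\<close>
  have sm_single: "sm {q}" for q
  proof -
    have eq: "f -` {q} \<inter> verts ?G = {v \<in> verts ?G. f v = q}" by auto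
    have "card {v \<in> verts ?G. f v = q} \<le> k j - 1"
    proof (cases "q \<in> verts (lad S)")
      case True
      then show ?thesis using cw by (auto simp: coarse_wiring_def)
    next
      case False
      then have none: "{v \<in> verts ?G. f v = q} = {}" using w by (auto simp: is_wiring_def)
      show ?thesis unfolding none by simp
    qed
    with card_cols_le[of s j "f -` {q}"] show ?thesis
      using k_ge[of j] unfolding sm_def eq by linarith
  qed
  have sm_out: "sm P" if "P \<inter> ?im = {}" for P
  proof -
    have "f -` P \<inter> verts ?G = {}" using that unfolding image_verts_def by blast
    with card_cols_le[of s j "f -` P"] show ?thesis using k_ge[of j] unfolding sm_def by simp
  qed
  \<comment> \<open>The part of row \<open>y\<close> at distance more than \<open>t\<close> from the
    spine, to the right for \<epsilon> = 1 and to the left for \<epsilon> = -1.\<close>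
  define tooth where "tooth \<epsilon> y t = {v. snd v = y \<and> t < \<epsilon> * (fst v - m)}" for \<epsilon> y t :: int
  have tooth: "sm (tooth \<epsilon> y 0)" if \<epsilon>: "\<epsilon> = 1 \<or> \<epsilon> = -1" for \<epsilon> y
  proof (rule ccontr)
    assume not_sm: "\<not> sm (tooth \<epsilon> y 0)"
    \<comment> \<open>Walking outwards: if the tooth beyond distance \<open>t\<close> is large, the
      rest is small, so removing the next single vertex leaves a large tooth.\<close>
    have "\<not> sm (tooth \<epsilon> y (int t))" for t
    proof (induction t)
      case (Suc t)
      have "sm (tooth \<epsilon> y t) \<or> sm (- tooth \<epsilon> y t)"
        by (rule sm_cut[of "{(m + \<epsilon> * t, y), (m + \<epsilon> * (t + 1), y)}"])
          (use \<epsilon> in \<open>auto simp: tooth_def insert_commute\<close>)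
      with Suc have 1: "sm (- tooth \<epsilon> y t)" by simp
      \<comment> \<open>The vertex is repeated only to fill up the five sets of
        \<open>sm_cover\<close>.\<close>
      have "- tooth \<epsilon> y t \<union> tooth \<epsilon> y (Suc t) \<union> {(m + \<epsilon> * (t + 1), y)} \<union>
          {(m + \<epsilon> * (t + 1), y)} \<union> {(m + \<epsilon> * (t + 1), y)} = UNIV"
        using \<epsilon> by (auto simp: tooth_def)
      with sm_cover[OF 1 _ sm_single sm_single sm_single] show ?case by blast
    qed (use not_sm in simp)
    \<comment> \<open>At distance \<open>S i\<close> the tooth has left the image, so it is small, a
      contradiction.\<close>
    moreover have "tooth \<epsilon> y (int (S i)) \<inter> ?im = {}"
      using near \<epsilon> by (fastforce simp: tooth_def)
    ultimately show False using sm_out by blast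
  qed
  define lower where "lower y = {v::int \<times> int. snd v \<le> y}" for y
  \<comment> \<open>Climbing the spine: the edge above row \<open>y + 1\<close> separates
    \<open>lower (y + 1)\<close> from the rows above.\<close>
  have step: "sm (lower (y + 1))" if "sm (lower y)" for y
  proof (rule ccontr)
    assume "\<not> sm (lower (y + 1))"
    moreover have "sm (lower (y + 1)) \<or> sm (- lower (y + 1))"
      by (rule sm_cut[of "{(m, y + 1), (m, y + 1 + 1)}"]) (auto simp: lower_def)
    ultimately have "sm (- lower (y + 1))" by simp
    \<comment> \<open>The four branches at the spine vertex \<open>(m, y + 1)\<close> and the vertex
      itself; this is where the number five comes from.\<close>
    moreover have "lower y \<union> - lower (y + 1) \<union> tooth 1 (y + 1) 0 \<union> tooth (-1) (y + 1) 0
        \<union> {(m, y + 1)} = UNIV"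
      by (auto simp: lower_def tooth_def)
    ultimately show False
      using sm_cover[OF that _ tooth tooth sm_single] by blast
  qed
  have im_rows: "snd v \<in> rows i" if "v \<in> ?im" for v
    using im that by (auto simp: verts_block)
  have low: "sm (lower (base i - 1 + int t))" for t
  proof (induction t)
    case 0
    show ?case using im_rows by (intro sm_out) (force simp: lower_def rows_def)
  next
    case (Suc t)
    from step[OF this] show ?case by (simp add: algebra_simps)
  qed
  \<comment> \<open>Above the top row of block \<open>i\<close> there is no image, so both sides of
    the last cut are small.\<close>
  have "sm (- lower (base i - 1 + int (k i)))"
    using im_rows by (intro sm_out) (force simp: lower_def rows_def)
  from sm_cover[OF low[of "k i"] this sm_single sm_single sm_single, of "(0, 0)" "(0, 0)" "(0, 0)"]
  show False by blast
qed

end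

section \<open>Upper bound: stretching the rows and collapsing one block\<close>

lemma strict_mono_intI:
  fixes h :: "int \<Rightarrow> int"
  assumes "\<And>x. h x < h (x + 1)"
  shows "strict_mono h"
proof (rule strict_monoI)
  fix x y :: int assume "x < y"
  then have "x + 1 \<le> y" by simp
  then show "h x < h y"
  proof (induction y rule: int_ge_induct)
    case (step y)
    with assms[of y] show ?case by simp
  qed (rule assms)
qed

text \<open>Each interval between consecutive multiples of s is lengthened to S at a single gap, placed
  where M holds if possible.\<close>

lemma stretch_exists:
  fixes s S :: int
  assumes s: "0 < s" "s \<le> S"
  shows "\<exists>h. (\<forall>x. h x < h (x + 1)) \<and> (\<forall>c. h (c * s) = c * S) \<and>
    ((\<forall>c. \<exists>x\<in>{c * s..<c * s + s}. M x) \<longrightarrow> (\<forall>x. \<not> M x \<longrightarrow> h (x + 1) = h x + 1))"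
proof -
  have "\<exists>x\<in>{c * s..<c * s + s}. M x \<or> (\<forall>x\<in>{c * s..<c * s + s}. \<not> M x)" for c
  proof (cases "\<exists>x\<in>{c * s..<c * s + s}. M x")
    case False
    moreover have "c * s \<in> {c * s..<c * s + s}" using s by simp
    ultimately show ?thesis by blast
  qed blast
  then obtain g where g: "\<And>c. g c \<in> {c * s..<c * s + s}"
    "\<And>c. M (g c) \<or> (\<forall>x\<in>{c * s..<c * s + s}. \<not> M x)" by metis
  \<comment> \<open>\<open>u x\<close> counts, with sign and starting from 0, the gaps passed on the
    way from 0 to \<open>x\<close>; the gap \<open>g c\<close> is passed between \<open>g c\<close>
    and \<open>g c + 1\<close>. Each passed gap adds \<open>S - s\<close> to
    \<open>h\<close>.\<close>
  define u where "u x = x div s + (if g (x div s) < x then 1 else 0)" for x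
  define h where "h x = x + (S - s) * u x" for x
  have u_step: "u (x + 1) = u x + (if x = g (x div s) then 1 else 0)" for x
  proof -
    define c where "c = x div s"
    have x: "c * s \<le> x" "x < c * s + s"
      using s by (auto simp: c_def minus_mod_eq_div_mult[symmetric])
    show ?thesis
    proof (cases "x + 1 = c * s + s")
      case True
      then have eq: "x + 1 = (c + 1) * s" by (simp add: algebra_simps)
      then have "(x + 1) div s = c + 1" using s by simp
      moreover have "\<not> g (c + 1) < x + 1" using g(1)[of "c + 1"] eq by auto
      moreover have "g c \<le> x" using g(1)[of c] True by auto
      ultimately show ?thesis by (auto simp: u_def c_def[symmetric])
    next
      case False
      then have "(x + 1) div s = c"
        using x by (intro int_div_pos_eq[of _ _ _ "x + 1 - c * s"]) (auto simp: algebra_simps)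
      then show ?thesis by (auto simp: u_def c_def[symmetric])
    qed
  qed
  have h_step: "h (x + 1) = h x + 1 + (if x = g (x div s) then S - s else 0)" for x
    unfolding h_def u_step by (auto simp: algebra_simps)
  have "h (c * s) = c * S" for c
    using g(1)[of c] s by (simp add: h_def u_def algebra_simps)
  moreover have "h (x + 1) = h x + 1" if "\<forall>c. \<exists>x\<in>{c * s..<c * s + s}. M x" "\<not> M x" for x
    using g(2)[of "x div s"] that unfolding h_step by auto
  moreover have "h x < h (x + 1)" for x
    using s unfolding h_step by auto
  ultimately show ?thesis by blast
qed

lemma path_edges_map_upto:
  "path_edges (map F [a..b]) = {{F t, F (t + 1)} | t. a \<le> t \<and> t < b}"
proof safe
  fix d assume "d \<in> path_edges (map F [a..b])"
  then obtain i where i: "Suc i < length [a..b]" "d = {map F [a..b] ! i, map F [a..b] ! Suc i}"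
    by (auto simp: path_edges_def)
  then have "d = {F (a + int i), F (a + int i + 1)}" by (simp add: ac_simps)
  with i show "\<exists>t. d = {F t, F (t + 1)} \<and> a \<le> t \<and> t < b"
    by (intro exI[of _ "a + int i"]) auto
next
  fix t assume t: "a \<le> t" "t < b"
  then have i: "Suc (nat (t - a)) < length [a..b]" by auto
  then have "{map F [a..b] ! nat (t - a), map F [a..b] ! Suc (nat (t - a))} = {F t, F (t + 1)}"
    using t by (simp add: ac_simps)
  with i show "{F t, F (t + 1)} \<in> path_edges (map F [a..b])"
    unfolding path_edges_def length_map by blast
qed

lemma is_path_map_upto:
  assumes "a \<le> b" "inj_on F {a..b}" "F ` {a..b} \<subseteq> verts Y"
    "\<And>t. a \<le> t \<Longrightarrow> t < b \<Longrightarrow> {F t, F (t + 1)} \<in> edges Y"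
  shows "is_path Y (map F [a..b])"
  unfolding is_path_def
proof (intro conjI allI impI)
  show "map F [a..b] \<noteq> []" using assms(1) by simp
  show "distinct (map F [a..b])" using assms(2) by (simp add: distinct_map)
  show "set (map F [a..b]) \<subseteq> verts Y" using assms(3) by simp
  fix i assume "Suc i < length (map F [a..b])"
  then have "{map F [a..b] ! i, map F [a..b] ! Suc i} \<in> path_edges (map F [a..b])"
    unfolding path_edges_def by blast
  then show "{map F [a..b] ! i, map F [a..b] ! Suc i} \<in> edges Y"
    using assms(4) unfolding path_edges_map_upto by auto
qed

lemma hd_last_map_upto:
  assumes "a \<le> b"
  shows "hd (map F [a..b]) = F a" "last (map F [a..b]) = F b"
  using assms by (simp_all add: hd_conv_nth last_conv_nth)

text \<open>Block \<open>j\<close> is the one to be collapsed, and \<open>h y\<close> stretches row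
  \<open>y\<close>. By \<open>h_col\<close> the stretchings of all rows of a block agree on its
  columns.\<close>

locale stretched_ladders = ladders +
  fixes s S :: "nat \<Rightarrow> nat" and j :: nat and h :: "int \<Rightarrow> int \<Rightarrow> int"
  assumes s_le: "s i \<le> S i"
    and h_less: "h y x < h y (x + 1)"
    and h_col: "h y (c * int (s (blk y))) = c * int (S (blk y))"
begin

text \<open>The collapsed block is not stretched: its target is a single row, where it meets no
  columns it must match, and this keeps the volume small.\<close>

definition xmap :: "int \<Rightarrow> int \<Rightarrow> int" where
  "xmap y = (if blk y = j then id else h y)"

definition ymap :: "int \<Rightarrow> int" where
  "ymap y = (if blk y = j then base j else y)"

definition vmap :: "int \<times> int \<Rightarrow> int \<times> int" where
  "vmap v = (xmap (snd v) (fst v), ymap (snd v))"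

text \<open>Edges are unordered, so their ends are recovered as minima and maxima of coordinates. A
  vertical edge of block \<open>j\<close> becomes a path with one vertex.\<close>

definition emap :: "(int \<times> int) set \<Rightarrow> (int \<times> int) list" where
  "emap e = (let x = Min (fst ` e); x' = Max (fst ` e); y = Min (snd ` e); y' = Max (snd ` e) in
     if y = y' then map (\<lambda>t. (t, ymap y)) [xmap y x..xmap y x']
     else map (\<lambda>t. (xmap y x, t)) [ymap y..ymap y'])"

lemma emap_hor: "emap {(x, y), (x + 1, y)} = map (\<lambda>t. (t, ymap y)) [xmap y x..xmap y (x + 1)]"
  by (simp add: emap_def)

lemma emap_ver: "emap {(x, y), (x, y + 1)} = map (\<lambda>t. (xmap y x, t)) [ymap y..ymap (y + 1)]"
  by (simp add: emap_def)

lemma strict_mono_xmap: "strict_mono (xmap y)"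
  by (rule strict_mono_intI) (simp add: xmap_def h_less)

lemma xmap_eq_iff: "xmap y x = xmap y x' \<longleftrightarrow> x = x'"
  using strict_mono_xmap by (rule strict_mono_eq)

lemma xmap_less_iff: "xmap y x < xmap y x' \<longleftrightarrow> x < x'"
  using strict_mono_xmap by (rule strict_mono_less)

text \<open>The value depends on the block but not on the row, so the ends of a vertical edge keep a
  common x-coordinate.\<close>

lemma xmap_col:
  assumes "y \<in> rows i" "int (s i) dvd x"
  shows "xmap y x = (if i = j then x else (x div int (s i)) * int (S i))"
  using h_col[of y "x div int (s i)"] assms rows_blk[OF assms(1)] by (auto simp: xmap_def)

lemma xmap_range:
  assumes y: "y \<in> rows i" and x: "0 \<le> x" "x \<le> width s i"
  shows "0 \<le> xmap y x \<and> xmap y x \<le> width S i"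
proof (cases "i = j")
  case True
  have "width s i \<le> width S i" using s_le[of i] by (simp add: width_def mult_left_mono)
  with True x y rows_blk[OF y] show ?thesis by (simp add: xmap_def)
next
  case False
  have "xmap y 0 \<le> xmap y x" "xmap y x \<le> xmap y (width s i)"
    using x strict_mono_xmap by (simp_all add: strict_mono_less_eq)
  moreover have "xmap y 0 = 0" "xmap y (width s i) = width S i"
    using h_col[of y 0] h_col[of y "int (5 * k i)"] False rows_blk[OF y]
    by (simp_all add: xmap_def width_def)
  ultimately show ?thesis by simp
qed

lemma ymap_rows: "y \<in> rows i \<Longrightarrow> ymap y \<in> rows i"
  using rows_blk base_in_rows by (auto simp: ymap_def)

text \<open>Only the row \<open>base j\<close> receives more than one row, namely those of block
  \<open>j\<close>. This is the sole source of the multiplicity \<open>k j\<close>.\<close>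

lemma ymap_preimage:
  shows "finite {y. y \<in> rows (blk y) \<and> ymap y = r}"
    and "card {y. y \<in> rows (blk y) \<and> ymap y = r} \<le> k j"
proof -
  let ?Q = "{y. y \<in> rows (blk y) \<and> ymap y = r}"
  have "\<exists>R. ?Q \<subseteq> R \<and> finite R \<and> card R \<le> k j"
  proof (cases "r = base j")
    case True
    then have "?Q \<subseteq> rows j" using base_in_rows rows_blk by (auto simp: ymap_def split: if_splits)
    then show ?thesis by (intro exI[of _ "rows j"]) (simp add: finite_rows card_rows)
  next
    case False
    then have "?Q \<subseteq> {r}" by (auto simp: ymap_def split: if_splits)
    then show ?thesis using k_ge[of j] by (intro exI[of _ "{r}"]) auto
  qed
  then show "finite ?Q" "card ?Q \<le> k j"
    by (meson finite_subset card_mono le_trans)+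
qed

lemma vmap_in_block: "v \<in> verts (block s i) \<Longrightarrow> vmap v \<in> verts (block S i)"
  using xmap_range ymap_rows by (auto simp: vmap_def verts_block)

lemma emap_is_path:
  assumes "e \<in> edges (block s i)"
  shows "is_path (lad S) (emap e) \<and> {hd (emap e), last (emap e)} = vmap ` e \<and>
    set (emap e) \<subseteq> verts (block S i)"
  using assms
proof (cases rule: edges_blockE)
  case (hor x y)
  have r: "0 \<le> xmap y x" "xmap y (x + 1) \<le> width S i" "xmap y x \<le> xmap y (x + 1)"
    using xmap_range[of y i x] xmap_range[of y i "x + 1"] hor xmap_less_iff[of y x "x + 1"] by auto
  have sub: "(\<lambda>t. (t, ymap y)) ` {xmap y x..xmap y (x + 1)} \<subseteq> verts (block S i)"
    using r ymap_rows[of y i] hor by (auto simp: verts_block)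
  have "is_path (lad S) (emap e)"
    unfolding hor(1) emap_hor
  proof (rule is_path_map_upto)
    fix t assume "xmap y x \<le> t" "t < xmap y (x + 1)"
    then have "{(t, ymap y), (t + 1, ymap y)} \<in> edges (block S i)"
      using r ymap_rows[of y i] hor by (intro hor_edge) auto
    then show "{(t, ymap y), (t + 1, ymap y)} \<in> edges (lad S)" by (auto simp: edges_lad)
  qed (use r sub in \<open>auto simp: verts_lad inj_on_def\<close>)
  moreover have "{hd (emap e), last (emap e)} = vmap ` e"
    unfolding hor(1) emap_hor hd_last_map_upto[OF r(3)] by (simp add: vmap_def)
  ultimately show ?thesis using sub unfolding hor(1) emap_hor by simp
next
  case (ver x y)
  have eq: "xmap (y + 1) x = xmap y x" using ver xmap_col by simp
  have le: "ymap y \<le> ymap (y + 1)" and rng: "0 \<le> xmap y x" "xmap y x \<le> width S i"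
    using ver rows_blk[of y i] rows_blk[of "y + 1" i] xmap_range[of y i x] by (auto simp: ymap_def)
  have in_rows: "t \<in> rows i" if "ymap y \<le> t" "t \<le> ymap (y + 1)" for t
    using that ymap_rows[OF ver(2)] ymap_rows[OF ver(3)] by (auto simp: rows_def)
  have sub: "(\<lambda>t. (xmap y x, t)) ` {ymap y..ymap (y + 1)} \<subseteq> verts (block S i)"
    using rng in_rows by (auto simp: verts_block)
  have "is_path (lad S) (emap e)"
    unfolding ver(1) emap_ver
  proof (rule is_path_map_upto)
    fix t assume t: "ymap y \<le> t" "t < ymap (y + 1)"
    \<comment> \<open>In block \<open>j\<close> both ends go to the row \<open>base j\<close>, which
      leaves no such \<open>t\<close>.\<close>
    then have "i \<noteq> j" using ver rows_blk[of y i] rows_blk[of "y + 1" i] by (auto simp: ymap_def)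
    then have "int (S i) dvd xmap y x" using xmap_col[OF ver(2,6)] by simp
    then have "{(xmap y x, t), (xmap y x, t + 1)} \<in> edges (block S i)"
      using rng in_rows t by (intro ver_edge) auto
    then show "{(xmap y x, t), (xmap y x, t + 1)} \<in> edges (lad S)" by (auto simp: edges_lad)
  qed (use le sub in \<open>auto simp: verts_lad inj_on_def\<close>)
  moreover have "{hd (emap e), last (emap e)} = vmap ` e"
    unfolding ver(1) emap_ver hd_last_map_upto[OF le] by (simp add: vmap_def eq)
  ultimately show ?thesis using sub unfolding ver(1) emap_ver by simp
qed

lemma emap_edgeE:
  assumes "e \<in> edges (lad s)" "d \<in> path_edges (emap e)"
  obtains (hor) x y t where "e = {(x, y), (x + 1, y)}" "y \<in> rows (blk y)"
      "d = {(t, ymap y), (t + 1, ymap y)}" "xmap y x \<le> t" "t < xmap y (x + 1)"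
  | (ver) x y where "e = {(x, y), (x, y + 1)}" "y \<in> rows (blk y)" "ymap y = y"
      "d = {(xmap y x, y), (xmap y x, y + 1)}"
proof -
  obtain i where "e \<in> edges (block s i)" using assms(1) by (auto simp: edges_lad)
  then show thesis
  proof (cases rule: edges_blockE)
    case h: (hor x y)
    have "d \<in> {{(t, ymap y), (t + 1, ymap y)} | t. xmap y x \<le> t \<and> t < xmap y (x + 1)}"
      using assms(2) unfolding h(1) emap_hor path_edges_map_upto .
    with h rows_blk[OF h(2)] show thesis by (auto intro: hor)
  next
    case v: (ver x y)
    have "d \<in> {{(xmap y x, t), (xmap y x, t + 1)} | t. ymap y \<le> t \<and> t < ymap (y + 1)}"
      using assms(2) unfolding v(1) emap_ver path_edges_map_upto .
    then obtain t where t: "d = {(xmap y x, t), (xmap y x, t + 1)}" "ymap y \<le> t" "t < ymap (y + 1)"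
      by auto
    then have "ymap y = y" "t = y"
      using rows_blk[OF v(2)] rows_blk[OF v(3)] by (auto simp: ymap_def split: if_splits)
    with v t rows_blk[OF v(2)] show thesis by (auto intro: ver)
  qed
qed

text \<open>Within one row, stretching is injective and sends different edges to segments without
  common edges. A preimage of a vertex or an edge is therefore determined by its row (the lower row
  for an edge), and at most \<open>k j\<close> rows are possible.\<close>

lemma coarse_wiring_stretch:
  assumes G: "subgraph G (lad s)"
  shows "coarse_wiring (k j) G (lad S) vmap emap"
  unfolding coarse_wiring_def
proof (intro conjI ballI)
  have V: "verts G \<subseteq> verts (lad s)" and E: "edges G \<subseteq> edges (lad s)"
    using G by (auto simp: subgraph_def)
  show "is_wiring G (lad S) vmap emap"
    unfolding is_wiring_def
  proof (intro conjI ballI)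
    fix v assume "v \<in> verts G"
    then show "vmap v \<in> verts (lad S)" using V vmap_in_block by (fastforce simp: verts_lad)
  next
    fix e assume "e \<in> edges G"
    then obtain i where "e \<in> edges (block s i)" using E by (auto simp: edges_lad)
    from emap_is_path[OF this]
    show "is_path (lad S) (emap e)" "{hd (emap e), last (emap e)} = vmap ` e" by auto
  qed
next
  fix w :: "int \<times> int"
  let ?Q = "{y. y \<in> rows (blk y) \<and> ymap y = snd w}"
  have "card {v \<in> verts G. vmap v = w} \<le> card ?Q"
  proof (rule card_inj_on_le[of snd])
    show "inj_on snd {v \<in> verts G. vmap v = w}"
      by (auto simp: inj_on_def vmap_def xmap_eq_iff)
    show "snd ` {v \<in> verts G. vmap v = w} \<subseteq> ?Q"
    proof safe
      fix x y assume "(x, y) \<in> verts G"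
      then obtain i where "y \<in> rows i"
        using G by (auto simp: subgraph_def verts_lad verts_block)
      then show "snd (x, y) \<in> rows (blk (snd (x, y)))" using rows_blk by auto
    qed (simp add: vmap_def)
  qed (rule ymap_preimage)
  with ymap_preimage(2) show "card {v \<in> verts G. vmap v = w} \<le> k j" by (rule order_trans[rotated])
next
  fix d assume "d \<in> edges (lad S)"
  let ?D = "{e \<in> edges G. d \<in> path_edges (emap e)}"
  let ?Q = "{y. y \<in> rows (blk y) \<and> ymap y = Min (snd ` d)}"
  have D: "e \<in> edges (lad s)" "d \<in> path_edges (emap e)" if "e \<in> ?D" for e
    using G that by (auto simp: subgraph_def)
  have "card ?D \<le> card ?Q"
  proof (rule card_inj_on_le[of "\<lambda>e. Min (snd ` e)"])
    show "(\<lambda>e. Min (snd ` e)) ` ?D \<subseteq> ?Q"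
    proof
      fix y0 assume "y0 \<in> (\<lambda>e. Min (snd ` e)) ` ?D"
      then obtain e where e: "e \<in> ?D" "y0 = Min (snd ` e)" by auto
      from D[OF e(1)] show "y0 \<in> ?Q"
        by (cases rule: emap_edgeE) (use e(2) in simp_all)
    qed
    show "inj_on (\<lambda>e. Min (snd ` e)) ?D"
    proof (rule inj_onI)
      fix e1 e2 assume e: "e1 \<in> ?D" "e2 \<in> ?D" "Min (snd ` e1) = Min (snd ` e2)"
      from D[OF e(1)] show "e1 = e2"
      proof (cases rule: emap_edgeE)
        case h1: (hor x y t)
        from D[OF e(2)] show ?thesis
        proof (cases rule: emap_edgeE)
          case h2: (hor x' y' t')
          have y: "y' = y" using e(3) h1(1) h2(1) by simp
          have "t' = t" using h1(3) h2(3) by (auto simp: doubleton_eq_iff)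
          \<comment> \<open>A unit edge common to both segments makes them overlap, which forces
            \<open>x = x'\<close>.\<close>
          then have "xmap y x < xmap y (x' + 1)" "xmap y x' < xmap y (x + 1)"
            using h1(4,5) h2(4,5) unfolding y by auto
          then have "x' = x" unfolding xmap_less_iff by simp
          with y h1(1) h2(1) show ?thesis by simp
        next
          case v2: (ver x' y')
          with h1(3) show ?thesis by (auto simp: doubleton_eq_iff)
        qed
      next
        case v1: (ver x y)
        from D[OF e(2)] show ?thesis
        proof (cases rule: emap_edgeE)
          case h2: (hor x' y' t')
          with v1(4) show ?thesis by (auto simp: doubleton_eq_iff)
        next
          case v2: (ver x' y')
          have y: "y' = y" using e(3) v1(1) v2(1) by simp
          have "xmap y x = xmap y x'" using v1(4) v2(4) unfolding y by (auto simp: doubleton_eq_iff)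
          then have "x' = x" unfolding xmap_eq_iff by simp
          with y v1(1) v2(1) show ?thesis by simp
        qed
      qed
    qed
  qed (rule ymap_preimage)
  with ymap_preimage(2) show "card ?D \<le> k j" by (rule order_trans[rotated])
qed

text \<open>Earlier target blocks are counted in full, block \<open>j\<close> contributes one
  unstretched row, and in later blocks no edge of \<open>G\<close> is lengthened, so its path
  consists of the images of its ends.\<close>

lemma vol_stretch_le:
  assumes G: "subgraph G (lad s)" and fin: "finite (verts G)"
    and gap: "\<And>x y. y \<in> rows (blk y) \<Longrightarrow> j < blk y \<Longrightarrow> {(x, y), (x + 1, y)} \<in> edges G \<Longrightarrow>
      h y (x + 1) = h y x + 1"
  shows "vol G vmap emap \<le>
    (\<Sum>i<j. card (verts (block S i))) + (5 * k j * s j + 1) + card (verts G)"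
proof -
  let ?A = "\<Union>i<j. verts (block S i)" and ?B = "{0..width s j} \<times> {base j}" and ?C = "vmap ` verts G"
  have V: "verts G \<subseteq> verts (lad s)" and E: "edges G \<subseteq> edges (lad s)" and wf: "wf_graph G"
    using G by (auto simp: subgraph_def)
  have "vmap v \<in> ?A \<union> ?B \<union> ?C" if "v \<in> verts G" for v using that by auto
  moreover have "set (emap e) \<subseteq> ?A \<union> ?B \<union> ?C" if e: "e \<in> edges G" for e
  proof -
    obtain i where i: "e \<in> edges (block s i)" using e E by (auto simp: edges_lad)
    have e_sub: "e \<subseteq> verts G" using wf e by (auto simp: wf_graph_def)
    consider "i < j" | "i = j" | "j < i" by linarith
    then show ?thesis
    proof cases
      case 1
      with emap_is_path[OF i] show ?thesis by blast
    next
      case 2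
      have "set (emap e) \<subseteq> ?B"
        using i
      proof (cases rule: edges_blockE)
        case (hor x y)
        then have "blk y = j" using rows_blk 2 by simp
        with hor 2 show ?thesis unfolding hor(1) emap_hor by (auto simp: xmap_def ymap_def)
      next
        case (ver x y)
        then have "blk y = j" "blk (y + 1) = j" using rows_blk 2 by simp_all
        with ver 2 show ?thesis unfolding ver(1) emap_ver by (auto simp: xmap_def ymap_def)
      qed
      then show ?thesis by blast
    next
      case 3
      have "set (emap e) \<subseteq> vmap ` e"
        using i
      proof (cases rule: edges_blockE)
        case (hor x y)
        then have "blk y = i" using rows_blk by simp
        moreover have "h y (x + 1) = h y x + 1" using gap[of y x] e hor \<open>blk y = i\<close> 3 by simp
        ultimately show ?thesis
          using 3 unfolding hor(1) emap_hor by (auto simp: xmap_def ymap_def vmap_def)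
      next
        case (ver x y)
        then have b: "blk y = i" "blk (y + 1) = i" using rows_blk by simp_all
        have "xmap (y + 1) x = xmap y x" using ver xmap_col by simp
        then show ?thesis
          using 3 b unfolding ver(1) emap_ver by (auto simp: ymap_def vmap_def)
      qed
      then show ?thesis using e_sub by blast
    qed
  qed
  ultimately have sub: "image_verts G vmap emap \<subseteq> ?A \<union> ?B \<union> ?C"
    unfolding image_verts_def by blast
  have "card (image_verts G vmap emap) \<le> card (?A \<union> ?B \<union> ?C)"
    using fin finite_verts_block by (intro card_mono sub) auto
  also have "\<dots> \<le> card ?A + card ?B + card ?C"
    by (intro order_trans[OF card_Un_le] add_mono card_Un_le order_refl)
  also have "\<dots> \<le> (\<Sum>i<j. card (verts (block S i))) + (5 * k j * s j + 1) + card (verts G)"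
  proof (intro add_mono card_image_le fin)
    show "card ?A \<le> (\<Sum>i<j. card (verts (block S i)))" by (rule card_UN_le) simp
    have "nat (width s j + 1) = 5 * k j * s j + 1"
      unfolding width_def by (metis of_nat_1 of_nat_add of_nat_mult nat_int)
    then show "card ?B \<le> 5 * k j * s j + 1" by (simp add: card_cartesian_product)
  qed
  finally show ?thesis by (simp add: vol_def)
qed

end

section \<open>Bounds for the wiring profiles\<close>

context ladders
begin

text \<open>In a later block, a row segment between consecutive columns has \<open>s i\<close> edges
  with distinct left ends. \<open>G\<close> has too few vertices to contain them all, so the
  stretching can be placed at an edge missing from \<open>G\<close>.\<close>

lemma exists_coarse_wiring_lad:
  assumes G: "subgraph G (lad s)" and fin: "finite (verts G)"
    and s: "\<And>i. 0 < s i" "\<And>i. s i \<le> S i"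
    and large: "\<And>i. j < i \<Longrightarrow> card (verts G) < s i"
  shows "\<exists>f p. coarse_wiring (k j) G (lad S) f p \<and>
    vol G f p \<le> (\<Sum>i<j. card (verts (block S i))) + (5 * k j * s j + 1) + card (verts G)"
proof -
  let ?M = "\<lambda>y x. {(x, y), (x + 1, y)} \<notin> edges G"
  have "\<forall>y. \<exists>h. (\<forall>x. h x < h (x + 1)) \<and> (\<forall>c. h (c * int (s (blk y))) = c * int (S (blk y))) \<and>
    ((\<forall>c. \<exists>x\<in>{c * int (s (blk y))..<c * int (s (blk y)) + int (s (blk y))}. ?M y x) \<longrightarrow>
      (\<forall>x. \<not> ?M y x \<longrightarrow> h (x + 1) = h x + 1))"
    using s by (intro allI stretch_exists) auto
  then obtain h where h: "\<And>y x. h y x < h y (x + 1)"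
    "\<And>y c. h y (c * int (s (blk y))) = c * int (S (blk y))"
    and step: "\<And>y x. (\<forall>c. \<exists>x\<in>{c * int (s (blk y))..<c * int (s (blk y)) + int (s (blk y))}. ?M y x)
      \<Longrightarrow> \<not> ?M y x \<Longrightarrow> h y (x + 1) = h y x + 1"
    by metis
  interpret stretched_ladders k base blk s S j h
    by unfold_locales (use s h in auto)
  have "vol G vmap emap \<le> (\<Sum>i<j. card (verts (block S i))) + (5 * k j * s j + 1) + card (verts G)"
  proof (rule vol_stretch_le[OF G fin])
    fix x y assume y: "j < blk y" and e: "{(x, y), (x + 1, y)} \<in> edges G"
    have "\<exists>x\<in>{c * int (s (blk y))..<c * int (s (blk y)) + int (s (blk y))}. ?M y x" for c
    proof (rule ccontr)
      let ?I = "{c * int (s (blk y))..<c * int (s (blk y)) + int (s (blk y))}"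
      assume "\<not> ?thesis"
      then have *: "{(x, y), (x + 1, y)} \<in> edges G" if "x \<in> ?I" for x using that by auto
      have "e \<subseteq> verts G" if "e \<in> edges G" for e
        using G that by (auto simp: subgraph_def wf_graph_def)
      with * have "(\<lambda>x. (x, y)) ` ?I \<subseteq> verts G" by blast
      then have "card ((\<lambda>x. (x, y)) ` ?I) \<le> card (verts G)" by (rule card_mono[OF fin])
      moreover have "card ((\<lambda>x. (x, y)) ` ?I) = s (blk y)"
        by (subst card_image) (auto simp: inj_on_def)
      ultimately show False using large[OF y] by simp
    qed
    with step e show "h y (x + 1) = h y x + 1" by blast
  qed
  with coarse_wiring_stretch[OF G] show ?thesis by blast
qed

lemma wir_profile_le:
  assumes "\<And>i. 0 < s i" "\<And>i. s i \<le> S i" and "\<And>i. j < i \<Longrightarrow> n < s i"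
  shows "wir_profile (k j) (lad s) (lad S) n \<le>
    enat ((\<Sum>i<j. card (verts (block S i))) + (5 * k j * s j + 1) + n)"
  unfolding wir_profile_def
proof (rule SUP_least)
  fix G assume "G \<in> {G. subgraph G (lad s) \<and> finite (verts G) \<and> card (verts G) \<le> n}"
  then have G: "subgraph G (lad s)" "finite (verts G)" "card (verts G) \<le> n" by auto
  have "card (verts G) < s i" if "j < i" for i using assms(3)[OF that] G(3) by simp
  from exists_coarse_wiring_lad[OF G(1,2) assms(1,2) this] obtain f p where
    cw: "coarse_wiring (k j) G (lad S) f p" and
    v: "vol G f p \<le> (\<Sum>i<j. card (verts (block S i))) + (5 * k j * s j + 1) + card (verts G)"
    by blast
  have "wir (k j) G (lad S) \<le> enat (vol G f p)"
    unfolding wir_def using cw by (intro INF_lower2[of "(f, p)"]) auto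
  also have "\<dots> \<le> enat ((\<Sum>i<j. card (verts (block S i))) + (5 * k j * s j + 1) + n)"
    using v G(3) by simp
  finally show "wir (k j) G (lad S) \<le> \<dots>" .
qed

lemma wir_profile_ge:
  assumes "0 < s j" "\<And>i. i < j \<Longrightarrow> card (verts (block S i)) \<le> 5 * k j * s j + 1"
    "\<And>i. j \<le> i \<Longrightarrow> N \<le> S i" "card (verts (block s j)) \<le> n"
  shows "enat N \<le> wir_profile (k j - 1) (lad s) (lad S) n"
proof -
  have "enat N \<le> wir (k j - 1) (block s j) (lad S)"
    unfolding wir_def
  proof (rule INF_greatest)
    fix q assume "q \<in> {(f, p). coarse_wiring (k j - 1) (block s j) (lad S) f p}"
    then obtain f p where "q = (f, p)" "coarse_wiring (k j - 1) (block s j) (lad S) f p" by auto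
    with vol_wiring_ge[OF this(2) assms(1-3)]
    show "enat N \<le> enat (vol (block s j) (fst q) (snd q))" by simp
  qed
  also have "\<dots> \<le> wir_profile (k j - 1) (lad s) (lad S) n"
    unfolding wir_profile_def
    using assms(4) subgraph_block_lad finite_verts_block by (intro SUP_upper) auto
  finally show ?thesis .
qed

end

text \<open>Total size of the first blocks of the target graph: block i of the source has column spacing
  offset k i + 1, and block i of the target the square of the number of vertices of that block.\<close>

primrec offset :: "(nat \<Rightarrow> nat) \<Rightarrow> nat \<Rightarrow> nat" where
  "offset k 0 = 0"
| "offset k (Suc i) = offset k i + k i * (5 * k i * (k i * (5 * k i * (offset k i + 1) + 1))\<^sup>2 + 1)"

section \<open>Concrete spacings and the bounds at the block sizes\<close>

context ladders
begin

definition spacing :: "nat \<Rightarrow> nat" where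
  "spacing i = offset k i + 1"

definition size_block :: "nat \<Rightarrow> nat" where
  "size_block i = k i * (5 * k i * spacing i + 1)"

text \<open>With n the size of the source block, a wiring of volume below \<open>n^2\<close> cannot
  reach two columns of the target.\<close>

definition spacing' :: "nat \<Rightarrow> nat" where
  "spacing' i = (size_block i)\<^sup>2"

lemma offset_Suc: "offset k (Suc i) = offset k i + card (verts (block spacing' i))"
  by (simp add: card_verts_block spacing'_def size_block_def spacing_def)

lemma sum_card_blocks: "(\<Sum>i<j. card (verts (block spacing' i))) = offset k j"
proof (induction j)
  case (Suc j)
  then show ?case by (simp add: offset_Suc del: offset.simps(2))
qed simp

lemma k_pos: "0 < k i"
  using k_ge[of i] by simp

lemma less_card_block: "m < k i * (5 * k i * m + 1)"
proof -
  have "m \<le> 5 * k i * m" using k_pos[of i] by simp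
  also have "\<dots> < 1 * (5 * k i * m + 1)" by simp
  also have "\<dots> \<le> k i * (5 * k i * m + 1)"
    using k_pos[of i] by (intro mult_right_mono) auto
  finally show ?thesis .
qed

lemma spacing'_less_offset:
  assumes "i < j"
  shows "spacing' i < offset k j"
proof -
  have "spacing' i < card (verts (block spacing' i))"
    unfolding card_verts_block by (rule less_card_block)
  also have "\<dots> \<le> offset k j"
    unfolding sum_card_blocks[symmetric] using assms by (intro member_le_sum) auto
  finally show ?thesis .
qed

lemma le_offset: "j \<le> offset k j"
proof (induction j)
  case (Suc j)
  have "0 < card (verts (block spacing' j))" using k_pos[of j] by (simp add: card_verts_block)
  with Suc show ?case unfolding offset_Suc by simp
qed simp

lemma spacing_less_size: "spacing i < size_block i"
  unfolding size_block_def by (rule less_card_block)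

lemma size_le_spacing': "size_block i \<le> spacing' i"
  by (simp add: spacing'_def power2_eq_square)

text \<open>This makes every graph of the size of block \<open>i\<close> miss an edge in each row
  segment of later blocks.\<close>

lemma size_less_spacing: "i < j \<Longrightarrow> size_block i < spacing j"
  using spacing'_less_offset[of i j] size_le_spacing'[of i] by (simp add: spacing_def)

lemma spacing_le_spacing': "spacing i \<le> spacing' i"
  using spacing_less_size[of i] size_le_spacing'[of i] by simp

text \<open>One row of source block \<open>j\<close> has at least as many vertices as all earlier
  target blocks together. They are thus too small to host the block in the lower bound and cheap in
  the upper bound.\<close>

lemma offset_le_width: "offset k j \<le> 5 * k j * spacing j + 1"
proof -
  have "spacing j \<le> 5 * k j * spacing j" using k_pos[of j] by simp
  then show ?thesis by (simp add: spacing_def)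
qed

lemma wir_profile_upper:
  "wir_profile (k j) (lad spacing) (lad spacing') (size_block j) \<le> enat (2 * size_block j)"
proof -
  have "wir_profile (k j) (lad spacing) (lad spacing') (size_block j) \<le>
      enat (offset k j + (5 * k j * spacing j + 1) + size_block j)"
    unfolding sum_card_blocks[symmetric]
    by (rule wir_profile_le) (auto simp: spacing_le_spacing' size_less_spacing, simp add: spacing_def)
  also have "\<dots> \<le> enat (2 * size_block j)"
  proof -
    \<comment> \<open>The earlier blocks and the collapsed row cost at most two rows, and the block
      has \<open>k j\<close> rows, at least two.\<close>
    have "offset k j + (5 * k j * spacing j + 1) \<le> 2 * (5 * k j * spacing j + 1)"
      using offset_le_width[of j] by simp
    also have "\<dots> \<le> size_block j"
      unfolding size_block_def using k_ge[of j] by (rule mult_right_mono) simp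
    finally show ?thesis by simp
  qed
  finally show ?thesis .
qed

lemma wir_profile_lower:
  "enat ((size_block j)\<^sup>2) \<le> wir_profile (k j - 1) (lad spacing) (lad spacing') (size_block j)"
proof (rule wir_profile_ge)
  show "0 < spacing j" by (simp add: spacing_def)
  show "card (verts (block spacing j)) \<le> size_block j"
    by (simp add: card_verts_block size_block_def)
next
  fix i assume "i < j"
  then have "card (verts (block spacing' i)) \<le> offset k j"
    unfolding sum_card_blocks[symmetric] by (intro member_le_sum) auto
  with offset_le_width[of j] show "card (verts (block spacing' i)) \<le> 5 * k j * spacing j + 1" by simp
next
  fix i assume "j \<le> i"
  then show "(size_block j)\<^sup>2 \<le> spacing' i"
    using size_less_spacing[of j i] spacing_less_size[of i] size_le_spacing'[of i]
      spacing'_less_offset[of j i] spacing_le_spacing'[of i]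
    by (cases "i = j") (auto simp: spacing'_def spacing_def)
qed

lemma infinite_sizes:
  assumes "\<And>m. \<exists>j\<ge>m. k j = l"
  shows "infinite {size_block j | j. k j = l}"
  unfolding infinite_nat_iff_unbounded
proof
  fix m
  obtain j where j: "m \<le> j" "k j = l" using assms by blast
  have "m < size_block j"
    using j(1) le_offset[of j] spacing_less_size[of j] by (simp add: spacing_def)
  with j(2) show "\<exists>n>m. n \<in> {size_block j | j. k j = l}" by blast
qed

end

section \<open>Placing the ladders in the grid\<close>

theorem theorem1p1:
  shows "\<exists>X Y :: (int \<times> int) graph. subgraph X grid2 \<and> subgraph Y grid2 \<and>
    (\<forall>k::nat. k \<ge> 2 \<longrightarrow> (\<exists>I :: nat set. infinite I \<and> (\<forall>n\<in>I.
       (\<forall>m. wir_profile (k - 1) X Y n = enat m \<longrightarrow>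
            real m \<ge> (real n / (real k * (real k + 1))) ^ 2) \<and>
       wir_profile k X Y n \<le> enat (2 * n))))"
proof -
  \<comment> \<open>Decoding pairs makes every value from 2 on occur infinitely often, while
    \<open>ks i\<close> stays at most \<open>i + 2\<close>.\<close>
  define ks where "ks i = 2 + fst (prod_decode i)" for i
  have ks_le: "ks i \<le> i + 2" for i
    using le_prod_encode_1[of "fst (prod_decode i)" "snd (prod_decode i)"] by (simp add: ks_def)
  \<comment> \<open>Block \<open>i\<close> starts at row \<open>(i + 1)^2\<close> and has at most
    \<open>i + 2\<close> rows, fewer than the \<open>2 * i + 3\<close> up to the next square, so the
    integer square root identifies the block.\<close>
  interpret ladders ks "\<lambda>i. (int i + 1)\<^sup>2" "\<lambda>y. floor_sqrt (nat y) - 1"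
  proof
    fix i y assume y: "(int i + 1)\<^sup>2 \<le> y" "y < (int i + 1)\<^sup>2 + int (ks i)"
    have "0 \<le> y" using y(1) zero_le_power2[of "int i + 1"] by linarith
    then obtain n where n: "y = int n" using nonneg_int_cases by blast
    have "int ((Suc i)\<^sup>2) \<le> int n" using y(1) n by (simp add: add.commute)
    moreover have "int n < int ((Suc (Suc i))\<^sup>2)"
      using y(2) n ks_le[of i] by (simp add: power2_eq_square algebra_simps)
    ultimately have "floor_sqrt n = Suc i" unfolding of_nat_le_iff of_nat_less_iff
      by (rule floor_sqrt_unique)
    then show "floor_sqrt (nat y) - 1 = i" using n by simp
  qed (simp add: ks_def)
  have "\<exists>I. infinite I \<and> (\<forall>n\<in>I.
      (\<forall>m. wir_profile (l - 1) (lad spacing) (lad spacing') n = enat m \<longrightarrow>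
        real m \<ge> (real n / (real l * (real l + 1))) ^ 2) \<and>
      wir_profile l (lad spacing) (lad spacing') n \<le> enat (2 * n))" if l: "2 \<le> l" for l
  proof (intro exI conjI ballI allI impI)
    show "infinite {size_block j | j. ks j = l}"
    proof (rule infinite_sizes)
      fix m
      have "m \<le> prod_encode (l - 2, m)" by (rule le_prod_encode_2)
      moreover have "ks (prod_encode (l - 2, m)) = l" using l by (simp add: ks_def)
      ultimately show "\<exists>j\<ge>m. ks j = l" by blast
    qed
    fix n assume "n \<in> {size_block j | j. ks j = l}"
    then obtain j where j: "n = size_block j" "l = ks j" by blast
    show "wir_profile l (lad spacing) (lad spacing') n \<le> enat (2 * n)"
      unfolding j by (rule wir_profile_upper)
    fix m assume "wir_profile (l - 1) (lad spacing) (lad spacing') n = enat m"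
    then have "n\<^sup>2 \<le> m" using wir_profile_lower[of j] unfolding j by simp
    then have "(real n)\<^sup>2 \<le> real m" by (metis of_nat_le_iff of_nat_power)
    \<comment> \<open>The bound \<open>n^2\<close> obtained is stronger than the one claimed, since
      the divisor is at least 1.\<close>
    moreover have "real n / (real l * (real l + 1)) \<le> real n"
    proof -
      have "1 * 1 \<le> real l * (real l + 1)" using l by (intro mult_mono) auto
      then show ?thesis by (simp add: divide_le_eq mult_le_cancel_left1)
    qed
    then have "(real n / (real l * (real l + 1)))\<^sup>2 \<le> (real n)\<^sup>2"
      by (intro power_mono) auto
    ultimately show "(real n / (real l * (real l + 1))) ^ 2 \<le> real m" by linarith
  qed
  then show ?thesis using subgraph_lad_grid by blast
qed

end
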